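(* Let $n\geq 2$ be an integer, let $D_{\mathrm{st}}=(1,2,\dots,n)$, and let $\mathcal{D}_n\left(\frac{n(n+1)}{2}\right)$ be the set of all $n$-dice whose faces sum to $\frac{n(n+1)}{2}$. Let $D\in\mathcal{D}_n\left(\frac{n(n+1)}{2}\right)$, and let $k,l,r$ be the non-negative integers with $k+l+r=n$ such that $D$ is of the form \[ D=(\underbrace{0,0,\dots,0}_{k\text{ zeros}},f_1,f_2,\dots,f_l,g_1,g_2,\dots,g_r), \] where $1\leq f_i\leq n$ for all $i\in\{1,\dots,l\}$ and $g_j\geq n+1$ for all $j\in\{1,\dots,r\}$. Then: (a) if $k<r$, then $D\prec D_{\mathrm{st}}$; (b) if $k=r$, then $D\precsim D_{\mathrm{st}}$, and $D\sim D_{\mathrm{st}}$ if and only if $g_j=n+1$ for all $j\in\{1,\dots,r\}$; (c) if $k>r$ and $g_j=n+1$ for all $j\in\{1,\dots,r\}$, then $D\succ D_{\mathrm{st}}$. Moreover, \[ \max\left\{\Delta(D,D_{\mathrm{st}})\;\middle|\; D\in\mathcal{D}_n\left(\tfrac{n(n+1)}{2}\right)\right\}=\left\lfloor\frac{n-1}{2}\right\rfloor, \] and this maximum is attained by: (i) if $n=2p+1$ with $p\in\mathbb{N}$, the die $D=(\underbrace{0,0,\dots,0}_{p\text{ zeros}},\underbrace{n,n,\dots,n}_{p+1\text{ times}})\in\mathcal{D}_n\left(\frac{n(n+1)}{2}\right)$; (ii) if $n=2p$ with $p\in\mathbb{N}$, any die in $\mathcal{D}_n\left(\frac{n(n+1)}{2}\right)$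 with exactly $p-1$ zeros and no face higher than $n$, such as $D=(\underbrace{0,0,\dots,0}_{p-1\text{ zeros}},p,\underbrace{n,n,\dots,n}_{p\text{ times}})$.
   Context: An $n$-die is a non-decreasing sequence $D=(h_1,h_2,\dots,h_n)$ of non-negative integers (repetitions allowed); the $h_i$ are its faces. For two $n$-dice $D=(h_1,\dots,h_n)$ and $D'=(h'_1,\dots,h'_n)$ put $\gamma(D,D')=\sum_{i=1}^n \mathrm{Card}\{j\in\{1,\dots,n\} \mid h_i>h'_j\}$ and $\Delta(D,D')=\gamma(D,D')-\gamma(D',D)$. One writes $D\succ D'$ if $\Delta(D,D')>0$, $D\prec D'$ if $\Delta(D,D')<0$, $D\sim D'$ if $\Delta(D,D')=0$, and $D\precsim D'$ if $\Delta(D,D')\leq 0$. *)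

theory Defs
  imports Complex_Main
begin

text \<open>An \<open>n\<close>-die is a sorted list of length \<open>n\<close>; the face \<open>h\<^sub>i\<close> of the die \<open>D\<close> is \<open>D ! (i - 1)\<close>.\<close>

definition is_die :: "nat \<Rightarrow> nat list \<Rightarrow> bool" where
  "is_die n D \<longleftrightarrow> length D = n \<and> sorted D"

definition dice :: "nat \<Rightarrow> nat \<Rightarrow> nat list set" where
  "dice n s = {D. is_die n D \<and> sum_list D = s}"

definition standard_die :: "nat \<Rightarrow> nat list" where
  "standard_die n = [1..<n + 1]"

text \<open>The common number \<open>n\<close> of faces is an explicit parameter; the following notions are
  meaningful only for lists of length \<open>n\<close>.\<close>

definition gamma :: "nat \<Rightarrow> nat list \<Rightarrow> nat list \<Rightarrow> nat" where
  "gamma n D D' = (\<Sum>i<n. card {j. j < n \<and> D ! i > D' ! j})"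

definition Delta :: "nat \<Rightarrow> nat list \<Rightarrow> nat list \<Rightarrow> int" where
  "Delta n D D' = int (gamma n D D') - int (gamma n D' D)"

definition die_succ :: "nat list \<Rightarrow> nat \<Rightarrow> nat list \<Rightarrow> bool" ("(_ \<succ>\<^bsub>_\<^esub> _)" [51, 0, 51] 50) where
  "D \<succ>\<^bsub>n\<^esub> D' \<longleftrightarrow> Delta n D D' > 0"

definition die_prec :: "nat list \<Rightarrow> nat \<Rightarrow> nat list \<Rightarrow> bool" ("(_ \<prec>\<^bsub>_\<^esub> _)" [51, 0, 51] 50) where
  "D \<prec>\<^bsub>n\<^esub> D' \<longleftrightarrow> Delta n D D' < 0"

definition die_sim :: "nat list \<Rightarrow> nat \<Rightarrow> nat list \<Rightarrow> bool" ("(_ \<sim>\<^bsub>_\<^esub> _)" [51, 0, 51] 50) where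
  "D \<sim>\<^bsub>n\<^esub> D' \<longleftrightarrow> Delta n D D' = 0"

definition die_precsim :: "nat list \<Rightarrow> nat \<Rightarrow> nat list \<Rightarrow> bool" ("(_ \<lesssim>\<^bsub>_\<^esub> _)" [51, 0, 51] 50) where
  "D \<lesssim>\<^bsub>n\<^esub> D' \<longleftrightarrow> Delta n D D' \<le> 0"

definition advantages :: "nat \<Rightarrow> int set" where
  "advantages n = {Delta n D (standard_die n) | D. D \<in> dice n (n * (n + 1) div 2)}"

definition die_form ::
  "nat \<Rightarrow> nat list \<Rightarrow> nat \<Rightarrow> nat \<Rightarrow> nat \<Rightarrow> nat list \<Rightarrow> nat list \<Rightarrow> bool" where
  "die_form n D k l r fs gs \<longleftrightarrow>
     k + l + r = n \<and> length fs = l \<and> length gs = r \<and>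
     D = replicate k 0 @ fs @ gs \<and>
     (\<forall>f\<in>set fs. 1 \<le> f \<and> f \<le> n) \<and> (\<forall>g\<in>set gs. n + 1 \<le> g)"

text \<open>Every die has such a form, so quantifying universally over all forms of a die is not vacuous.\<close>

lemma ex_die_form:
  assumes "is_die n D"
  shows "\<exists>k l r fs gs. die_form n D k l r fs gs"
proof -
  have "\<exists>k fs gs. D = replicate k 0 @ fs @ gs \<and>
      (\<forall>f\<in>set fs. 1 \<le> f \<and> f \<le> n) \<and> (\<forall>g\<in>set gs. n + 1 \<le> g)"
    if "sorted D" for D :: "nat list"
    using that
  proof (induction D)
    case Nil
    then show ?case by simp
  next
    case (Cons a D)
    then obtain k fs gs where D: "D = replicate k 0 @ fs @ gs"
      and fs: "\<forall>f\<in>set fs. 1 \<le> f \<and> f \<le> n" and gs: "\<forall>g\<in>set gs. n + 1 \<le> g"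
      by auto
    consider "a = 0" | "1 \<le> a" "a \<le> n" | "n + 1 \<le> a" by linarith
    then show ?case
    proof cases
      case 1
      then have "a # D = replicate (Suc k) 0 @ fs @ gs" using D by simp
      then show ?thesis using fs gs by blast
    next
      case 2
      then have "k = 0" using Cons.prems D by (cases k) auto
      then have "a # D = replicate 0 0 @ (a # fs) @ gs" using D by simp
      moreover have "\<forall>f\<in>set (a # fs). 1 \<le> f \<and> f \<le> n" using 2 fs by simp
      ultimately show ?thesis using gs by blast
    next
      case 3
      then have "\<forall>g\<in>set (a # D). n + 1 \<le> g" using Cons.prems by force
      moreover have "a # D = replicate 0 0 @ [] @ (a # D)" by simp
      moreover have "\<forall>f\<in>set []. 1 \<le> f \<and> f \<le> n" by simp
      ultimately show ?thesis by blast
    qed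
  qed
  then obtain k fs gs where *: "D = replicate k 0 @ fs @ gs"
      "\<forall>f\<in>set fs. 1 \<le> f \<and> f \<le> n" "\<forall>g\<in>set gs. n + 1 \<le> g"
    using assms unfolding is_die_def by blast
  have "die_form n D k (length fs) (length gs) fs gs"
    using assms * by (auto simp: die_form_def is_die_def)
  then show ?thesis by blast
qed

text \<open>\<open>Max\<close> is only specified on finite nonempty sets.\<close>

lemma finite_advantages: "finite (advantages n)"
proof -
  have "dice n s \<subseteq> {D. set D \<subseteq> {..s} \<and> length D = n}" for s
    by (auto simp: dice_def is_die_def intro: member_le_sum_list)
  then have "finite (dice n (n * (n + 1) div 2))"
    by (rule finite_subset) (simp add: finite_lists_length_eq)
  moreover have "advantages n = (\<lambda>D. Delta n D (standard_die n)) ` dice n (n * (n + 1) div 2)"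
    by (auto simp: advantages_def)
  ultimately show ?thesis by simp
qed

lemma standard_die_in_dice: "standard_die n \<in> dice n (n * (n + 1) div 2)"
proof -
  have "sum_list [1..<n + 1] = n * (n + 1) div 2" for n :: nat
    by (induction n) auto
  then show ?thesis
    by (auto simp: dice_def is_die_def standard_die_def simp del: upt_Suc)
qed

end

theory Submission
  imports Defs
begin

text \<open>Against the standard die, a face \<open>h\<close> with \<open>1 \<le> h \<le> n\<close> contributes \<open>2 * h - n - 1\<close> to
  \<open>Delta\<close>. Summed over all faces this expression vanishes, so only the deviations of the other
  faces matter: a zero contributes one more than the expression, and a face \<open>g > n\<close> contributes
  \<open>n\<close>, which is \<open>1 + 2 * (g - n - 1)\<close> less. Hence
  \<open>Delta = k - r - 2 * S\<close> with \<open>S = (\<Sum>j. g\<^sub>j - n - 1)\<close>. For the maximum, bounding each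
  \<open>f\<^sub>i\<close> by \<open>n\<close> in the sum of the faces gives \<open>n * k \<le> n * (n - 1) / 2 + r + S\<close>,
  and therefore \<open>n * Delta \<le> n * (n - 1) / 2\<close>.\<close>

text \<open>A face \<open>h\<close> beats the faces 1, ..., h - 1 and loses to h + 1, ..., n.
  Truncated subtraction keeps both counts right for \<open>h = 0\<close> and for
  \<open>h > n\<close>.\<close>

lemma Delta_standard_die:
  assumes "length D = n"
  shows "Delta n D (standard_die n) = (\<Sum>h\<leftarrow>D. int (min (h - 1) n) - int (n - h))"
proof -
  have nth: "standard_die n ! j = j + 1" if "j < n" for j
    using that by (simp add: standard_die_def del: upt_Suc)
  have "{j. j < n \<and> h > standard_die n ! j} = {..<min (h - 1) n}" for h
    using nth by auto
  then have win: "gamma n D (standard_die n) = (\<Sum>i<n. min (D ! i - 1) n)"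
    by (simp add: gamma_def)
  have card_lose: "(\<Sum>i<n. of_bool (h < standard_die n ! i)) = n - h" for h
  proof -
    have "{..<n} \<inter> {i. h < standard_die n ! i} = {h..<n}"
      using nth by auto
    then show ?thesis by (simp add: sum.If_cases of_bool_def)
  qed
  \<comment> \<open>Here \<open>gamma\<close> groups the pairs by faces of the standard die;
    swapping the sums regroups them by faces of \<open>D\<close>, so that wins and losses combine
    face by face.\<close>
  have "gamma n (standard_die n) D = (\<Sum>i<n. \<Sum>j<n. of_bool (D ! j < standard_die n ! i))"
    by (simp add: gamma_def of_bool_def sum.If_cases lessThan_def Collect_conj_eq)
  also have "\<dots> = (\<Sum>j<n. n - D ! j)"
    by (subst sum.swap) (simp add: card_lose)
  finally have lose: "gamma n (standard_die n) D = (\<Sum>j<n. n - D ! j)" .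
  show ?thesis
    using assms by (simp add: Delta_def win lose sum_list_sum_nth atLeast0LessThan sum_subtractf)
qed

lemma sum_list_minus_const:
  fixes f :: "'a \<Rightarrow> int"
  shows "(\<Sum>x\<leftarrow>xs. f x - c) = (\<Sum>x\<leftarrow>xs. f x) - int (length xs) * c"
  by (induction xs) (auto simp: algebra_simps)

lemma die_form_sum:
  assumes "D \<in> dice n (n * (n + 1) div 2)" "die_form n D k l r fs gs"
  shows "2 * (\<Sum>f\<leftarrow>fs. int f) + 2 * (\<Sum>g\<leftarrow>gs. int g) = int n * (int n + 1)"
proof -
  have "2 * sum_list D = n * (n + 1)"
    using assms(1) by (simp add: dice_def)
  moreover have "sum_list D = sum_list fs + sum_list gs"
    using assms(2) by (simp add: die_form_def sum_list_replicate)
  ultimately have "2 * (sum_list fs + sum_list gs) = n * (n + 1)" by simp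
  then have "int (2 * (sum_list fs + sum_list gs)) = int (n * (n + 1))" by simp
  moreover have "int (sum_list xs) = (\<Sum>x\<leftarrow>xs. int x)" for xs
    by (induction xs) auto
  ultimately show ?thesis by (simp add: algebra_simps)
qed

lemma Delta_die_form:
  assumes "D \<in> dice n (n * (n + 1) div 2)" "die_form n D k l r fs gs"
  shows "Delta n D (standard_die n) = int k - int r - 2 * (\<Sum>g\<leftarrow>gs. int g - (int n + 1))"
proof -
  have D: "D = replicate k 0 @ fs @ gs" "length fs = l" "length gs = r" "k + l + r = n"
    and len: "length D = n"
    using assms by (auto simp: dice_def is_die_def die_form_def)
  have fs: "(\<Sum>h\<leftarrow>fs. int (min (h - 1) n) - int (n - h)) = (\<Sum>h\<leftarrow>fs. 2 * int h - (int n + 1))"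
    using assms(2) by (intro arg_cong[where f = sum_list] map_cong) (auto simp: die_form_def)
  have gs: "(\<Sum>h\<leftarrow>gs. int (min (h - 1) n) - int (n - h)) = (\<Sum>h\<leftarrow>gs. int n)"
    using assms(2) by (intro arg_cong[where f = sum_list] map_cong) (auto simp: die_form_def)
  have "Delta n D (standard_die n) =
      - int k * int n + (2 * (\<Sum>f\<leftarrow>fs. int f) - int l * (int n + 1)) + int r * int n"
    unfolding Delta_standard_die[OF len]
    by (simp add: D(1) fs gs sum_list_replicate sum_list_minus_const sum_list_const_mult
        sum_list_triv D(2,3) del: One_nat_def)
  \<comment> \<open>The prescribed total eliminates the unknown sum over \<open>fs\<close>; writing
    \<open>n\<close> as \<open>k + l + r\<close> then cancels the terms in \<open>l\<close>.\<close>
  also have "\<dots> = int k - int r - 2 * ((\<Sum>g\<leftarrow>gs. int g) - int r * (int n + 1))"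
    using die_form_sum[OF assms] by (simp add: algebra_simps flip: D(4))
  finally show ?thesis by (simp add: sum_list_minus_const D(3))
qed

lemma excess_nonneg:
  assumes "die_form n D k l r fs gs"
  shows "0 \<le> (\<Sum>g\<leftarrow>gs. int g - (int n + 1))"
  using assms by (intro sum_list_nonneg) (auto simp: die_form_def)

text \<open>A sum of nonnegative terms vanishes only if each term does. This yields the equality
  case for \<open>k = r\<close>.\<close>

lemma excess_eq_0_iff:
  assumes "die_form n D k l r fs gs"
  shows "(\<Sum>g\<leftarrow>gs. int g - (int n + 1)) = 0 \<longleftrightarrow> (\<forall>g\<in>set gs. g = n + 1)"
  using assms by (subst sum_list_nonneg_eq_0_iff) (auto simp: die_form_def)

lemma Delta_standard_die_le:
  assumes "n > 0" "D \<in> dice n (n * (n + 1) div 2)"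
  shows "Delta n D (standard_die n) \<le> int ((n - 1) div 2)"
proof -
  obtain k l r fs gs where form: "die_form n D k l r fs gs"
    using assms(2) ex_die_form unfolding dice_def by blast
  define S where "S = (\<Sum>g\<leftarrow>gs. int g - (int n + 1))"
  have len: "length fs = l" "length gs = r" "k + l + r = n"
    using form by (auto simp: die_form_def)
  have "(\<Sum>f\<leftarrow>fs. int f) \<le> (\<Sum>f\<leftarrow>fs. int n)"
    using form by (intro sum_list_mono) (auto simp: die_form_def)
  then have "int n * (int n + 1) \<le> 2 * (int n * int l + S + int r * (int n + 1))"
    using die_form_sum[OF assms(2) form]
    by (simp add: sum_list_triv S_def sum_list_minus_const len algebra_simps)
  \<comment> \<open>Substitute \<open>l = n - k - r\<close>.\<close>
  then have "int n * (2 * int k) \<le> int n * (int n - 1) + 2 * (int r + S)"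
    by (simp add: algebra_simps flip: len(3))
  \<comment> \<open>The weaker bound is chosen so that moving its last term to the left turns
    \<open>k\<close> into \<open>k - r - 2 * S\<close>, which is \<open>Delta\<close>.\<close>
  also have "\<dots> \<le> int n * (int n - 1) + int n * (2 * (int r + 2 * S))"
  proof -
    have "0 \<le> S" using excess_nonneg[OF form] by (simp add: S_def)
    then have "1 * (2 * (int r + S)) \<le> int n * (2 * (int r + 2 * S))"
      using \<open>n > 0\<close> by (intro mult_mono) auto
    then show ?thesis by simp
  qed
  finally have "int n * (2 * Delta n D (standard_die n)) \<le> int n * (int n - 1)"
    by (simp add: Delta_die_form[OF assms(2) form] S_def algebra_simps)
  then have "2 * Delta n D (standard_die n) \<le> int n - 1"
    using \<open>n > 0\<close> by simp
  then show ?thesis using \<open>n > 0\<close> by linarith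
qed

lemma count_list_replicate: "count_list (replicate n x) y = (if x = y then n else 0)"
  by (induction n) auto

lemma die_form_of_faces_le:
  assumes "is_die n D" "\<forall>h\<in>set D. h \<le> n" "die_form n D k l r fs gs"
  shows "k = count_list D 0" "r = 0" "gs = []"
proof -
  have "gs = []"
    using assms(2,3) by (cases gs) (auto simp: die_form_def)
  moreover have "count_list fs 0 = 0"
    using assms(3) by (auto simp: die_form_def count_list_0_iff)
  ultimately show "k = count_list D 0" "r = 0" "gs = []"
    using assms(3) by (auto simp: die_form_def count_list_replicate)
qed

text \<open>Without faces above \<open>n\<close>, both \<open>r\<close> and the excess of
  \<open>gs\<close> vanish, so only \<open>k\<close> survives. Attaining the maximum thus reduces to
  counting zeros.\<close>

lemma Delta_of_faces_le:
  assumes "D \<in> dice n (n * (n + 1) div 2)" "\<forall>h\<in>set D. h \<le> n"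
  shows "Delta n D (standard_die n) = int (count_list D 0)"
proof -
  have die: "is_die n D" using assms(1) by (simp add: dice_def)
  obtain k l r fs gs where form: "die_form n D k l r fs gs"
    using ex_die_form[OF die] by blast
  show ?thesis
    using Delta_die_form[OF assms(1) form] die_form_of_faces_le[OF die assms(2) form] by simp
qed

lemma odd_optimal_die:
  assumes "n = 2 * p + 1" and D: "D = replicate p 0 @ replicate (p + 1) n"
  shows "D \<in> dice n (n * (n + 1) div 2)" "count_list D 0 = p" "\<forall>h\<in>set D. h \<le> n"
  using assms
  by (auto simp: dice_def is_die_def sorted_append sum_list_replicate count_list_replicate
      simp del: replicate_Suc)

text \<open>The required total is \<open>p * (n + 1)\<close>, and \<open>p\<close> faces equal to
  \<open>n\<close> leave exactly \<open>p\<close> for the one remaining nonzero face.\<close>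

lemma even_optimal_die:
  assumes "n = 2 * p" "p > 0" and D: "D = replicate (p - 1) 0 @ [p] @ replicate p n"
  shows "D \<in> dice n (n * (n + 1) div 2)" "count_list D 0 = p - 1" "\<forall>h\<in>set D. h \<le> n"
  using assms
  by (auto simp: dice_def is_die_def sorted_append sum_list_replicate count_list_replicate algebra_simps)

lemma Max_advantages:
  assumes "n > 0"
  shows "Max (advantages n) = int ((n - 1) div 2)"
proof (rule Max_eqI[OF finite_advantages])
  show "x \<le> int ((n - 1) div 2)" if "x \<in> advantages n" for x
    using that Delta_standard_die_le[OF assms] by (auto simp: advantages_def)
  \<comment> \<open>The number of zeros, \<open>(n - 1) div 2\<close>, is \<open>p\<close> for
    \<open>n = 2 * p + 1\<close> and \<open>p - 1\<close> for \<open>n = 2 * p\<close>.\<close>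
  have "\<exists>D\<in>dice n (n * (n + 1) div 2). count_list D 0 = (n - 1) div 2 \<and> (\<forall>h\<in>set D. h \<le> n)"
  proof (cases "even n")
    case True
    then obtain p where "n = 2 * p" by blast
    then show ?thesis
      using even_optimal_die[of n p] assms
      by (intro bexI[of _ "replicate (p - 1) 0 @ [p] @ replicate p n"]) auto
  next
    case False
    then obtain p where "n = 2 * p + 1" by (blast elim: oddE)
    then show ?thesis
      using odd_optimal_die[of n p]
      by (intro bexI[of _ "replicate p 0 @ replicate (p + 1) n"]) auto
  qed
  then obtain D where D: "D \<in> dice n (n * (n + 1) div 2)"
    and "count_list D 0 = (n - 1) div 2" "\<forall>h\<in>set D. h \<le> n" by blast
  then have "Delta n D (standard_die n) = int ((n - 1) div 2)"
    using Delta_of_faces_le by simp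
  then show "int ((n - 1) div 2) \<in> advantages n"
    using D unfolding advantages_def by force
qed

theorem theorem4p3:
  fixes n :: nat
  assumes "n \<ge> 2"
  shows "(\<forall>D\<in>dice n (n * (n + 1) div 2). \<forall>k l r fs gs. die_form n D k l r fs gs \<longrightarrow>
           (k < r \<longrightarrow> D \<prec>\<^bsub>n\<^esub> standard_die n) \<and>
           (k = r \<longrightarrow> D \<lesssim>\<^bsub>n\<^esub> standard_die n \<and>
              (D \<sim>\<^bsub>n\<^esub> standard_die n \<longleftrightarrow> (\<forall>g\<in>set gs. g = n + 1))) \<and>
           (k > r \<and> (\<forall>g\<in>set gs. g = n + 1) \<longrightarrow> D \<succ>\<^bsub>n\<^esub> standard_die n)) \<and>
         Max (advantages n) = \<lfloor>(real n - 1) / 2\<rfloor> \<and>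
         (\<forall>p::nat. n = 2 * p + 1 \<longrightarrow>
           (let D = replicate p 0 @ replicate (p + 1) n
            in D \<in> dice n (n * (n + 1) div 2) \<and>
               Delta n D (standard_die n) = Max (advantages n))) \<and>
         (\<forall>p::nat. n = 2 * p \<longrightarrow>
           (\<forall>D\<in>dice n (n * (n + 1) div 2).
              count_list D 0 = p - 1 \<and> (\<forall>h\<in>set D. h \<le> n) \<longrightarrow>
              Delta n D (standard_die n) = Max (advantages n)) \<and>
           (let D = replicate (p - 1) 0 @ [p] @ replicate p n
            in D \<in> dice n (n * (n + 1) div 2) \<and>
               count_list D 0 = p - 1 \<and> (\<forall>h\<in>set D. h \<le> n)))"
proof (intro conjI ballI allI impI)
  fix D k l r fs gs
  assume D: "D \<in> dice n (n * (n + 1) div 2)" and form: "die_form n D k l r fs gs"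
  \<comment> \<open>All comparisons read off the sign of \<open>k - r - 2 * S\<close>, where S \<ge>
    0 is the total excess of \<open>gs\<close> over \<open>n + 1\<close>.\<close>
  note facts = Delta_die_form[OF D form] excess_nonneg[OF form] excess_eq_0_iff[OF form]
  show "D \<prec>\<^bsub>n\<^esub> standard_die n" if "k < r"
    using that facts unfolding die_prec_def by linarith
  show "D \<lesssim>\<^bsub>n\<^esub> standard_die n" if "k = r"
    using that facts unfolding die_precsim_def by linarith
  show "D \<sim>\<^bsub>n\<^esub> standard_die n \<longleftrightarrow> (\<forall>g\<in>set gs. g = n + 1)" if "k = r"
    using that facts unfolding die_sim_def by simp
  show "D \<succ>\<^bsub>n\<^esub> standard_die n" if "k > r \<and> (\<forall>g\<in>set gs. g = n + 1)"
    using that facts unfolding die_succ_def by simp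
next
  have "\<lfloor>real_of_int (int n - 1) / real_of_int 2\<rfloor> = (int n - 1) div 2"
    by (rule floor_divide_of_int_eq)
  then show "Max (advantages n) = \<lfloor>(real n - 1) / 2\<rfloor>"
    using assms by (simp add: Max_advantages zdiv_int of_nat_diff)
next
  fix p assume n: "n = 2 * p + 1"
  show "let D = replicate p 0 @ replicate (p + 1) n
        in D \<in> dice n (n * (n + 1) div 2) \<and> Delta n D (standard_die n) = Max (advantages n)"
    using odd_optimal_die[OF n refl] n
    by (simp only: Let_def Delta_of_faces_le Max_advantages) simp
next
  fix p D
  assume n: "n = 2 * p" and D: "D \<in> dice n (n * (n + 1) div 2)"
    and faces: "count_list D 0 = p - 1 \<and> (\<forall>h\<in>set D. h \<le> n)"
  have "(n - 1) div 2 = p - 1" using n assms by linarith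
  then show "Delta n D (standard_die n) = Max (advantages n)"
    using Delta_of_faces_le[OF D] faces assms by (simp add: Max_advantages)
next
  fix p assume n: "n = 2 * p"
  then have "p > 0" using assms by simp
  then show "let D = replicate (p - 1) 0 @ [p] @ replicate p n
        in D \<in> dice n (n * (n + 1) div 2) \<and> count_list D 0 = p - 1 \<and> (\<forall>h\<in>set D. h \<le> n)"
    using even_optimal_die[OF n _ refl] by (simp only: Let_def) simp
qed

end
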